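(* Let $\Omega\subset\mathbb{C}$ be a simply-connected domain. Suppose $$T(z) = D - zI + E(z), \qquad z\in\Omega,$$ is regular, where $D \in \mathbb{C}^{n \times n}$ is diagonal with diagonal entries $d_{ii}$ and $E : \Omega \to \mathbb{C}^{n \times n}$ is analytic with entries $e_{ij}$. Suppose also that the absolute row and column sums of $E$ are uniformly bounded, i.e. there are real constants $r_1,\dots,r_n$ and $c_1,\dots,c_n$ such that for all $z \in \Omega$, $$\sum_{j=1}^n |e_{ij}(z)| \le r_i \ \ (1\le i\le n), \qquad \sum_{i=1}^n |e_{ij}(z)| \le c_j \ \ (1\le j\le n).$$ Then for any $0 \le \alpha \le 1$, the eigenvalues of $T$ lie in $\bigcup_{i=1}^n G_i$, where the $G_i$ are generalized Gershgorin disks $$G_i = \{ z \in \mathbb{C} : |z-d_{ii}| \le \rho_i \}, \qquad \rho_i = r_i^{\alpha} c_i^{1-\alpha}.$$ Furthermore, if $\mathcal{U}$ is a union of $k$ of these disks which are disjoint from the remaining disks, and if $\mathcal{U} \subset \Omega$, then $\mathcal{U}$ contains exactly $k$ eigenvalues of $T$, counting multiplicity.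
   Context: An analytic $T:\Omega\to\mathbb{C}^{n\times n}$ is regular if $\det T(z)\not\equiv 0$ on $\Omega$. A point $\lambda\in\Omega$ is an eigenvalue of $T$ if $T(\lambda)$ is singular; its multiplicity is the order of the zero of $\det T(z)$ at $\lambda$. Eigenvalues in a region are counted with multiplicity. The convention $0^0=1$ is used, so that $\rho_i=c_i$ for $\alpha=0$ and $\rho_i=r_i$ for $\alpha=1$. *)

theory Defs
  imports "HOL-Complex_Analysis.Complex_Analysis"
begin

definition analytic_matrix :: "(complex \<Rightarrow> complex^'n^'n) \<Rightarrow> complex set \<Rightarrow> bool" where
  "analytic_matrix T \<Omega> \<longleftrightarrow> (\<forall>i j. (\<lambda>z. T z $ i $ j) analytic_on \<Omega>)"

definition regular_matrix :: "(complex \<Rightarrow> complex^'n^'n) \<Rightarrow> complex set \<Rightarrow> bool" where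
  "regular_matrix T \<Omega> \<longleftrightarrow> analytic_matrix T \<Omega> \<and> (\<exists>z\<in>\<Omega>. det (T z) \<noteq> 0)"

definition matrix_eigenvalues :: "(complex \<Rightarrow> complex^'n^'n) \<Rightarrow> complex set \<Rightarrow> complex set" where
  "matrix_eigenvalues T \<Omega> = {z\<in>\<Omega>. \<not> invertible (T z)}"

definition eigenvalue_mult :: "(complex \<Rightarrow> complex^'n^'n) \<Rightarrow> complex \<Rightarrow> int" where
  "eigenvalue_mult T z = zorder (\<lambda>w. det (T w)) z"

text \<open>
  The library has \<open>0 powr 0 = 0\<close>, whereas the radii below need \<open>0\<^sup>0 = 1\<close>.
\<close>
definition rpow :: "real \<Rightarrow> real \<Rightarrow> real" where
  "rpow x a = (if a = 0 then 1 else x powr a)"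

definition gersh_radius :: "real \<Rightarrow> real \<Rightarrow> real \<Rightarrow> real" where
  "gersh_radius \<alpha> r c = rpow r \<alpha> * rpow c (1 - \<alpha>)"

definition gersh_disk :: 
  "complex^'n^'n \<Rightarrow> ('n \<Rightarrow> real) \<Rightarrow> ('n \<Rightarrow> real) \<Rightarrow> real \<Rightarrow> 'n \<Rightarrow> complex set" where
  "gersh_disk D r c \<alpha> i = cball (D $ i $ i) (gersh_radius \<alpha> (r i) (c i))"

end

theory Submission
  imports Defs
begin

text \<open>
  Two ideas carry the proof.

  Localization is Ostrowski's interpolation between row and column sums. A null vector \<open>x\<close> of
  \<open>D - z I + B\<close> satisfies \<open>(z - d\<^sub>i) x\<^sub>i = \<Sum>\<^sub>j B\<^sub>i\<^sub>j x\<^sub>j\<close>. Hoelder's inequality with weights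
  \<open>\<bar>B\<^sub>i\<^sub>j\<bar>\<close> splits off the factor \<open>r\<^sub>i\<^sup>\<alpha>\<close>; if \<open>z\<close> lay outside every disk, what is left would say that
  \<open>c\<^sub>i y\<^sub>i\<close> is at most \<open>\<Sum>\<^sub>j \<bar>B\<^sub>i\<^sub>j\<bar> y\<^sub>j\<close> with \<open>y\<^sub>i = \<bar>x\<^sub>i\<bar>\<close> to the power \<open>1/(1-\<alpha>)\<close>, strictly for some \<open>i\<close>,
  and summing over \<open>i\<close> contradicts the bound on the column sums (\<open>Ostrowski_disk\<close>).

  Counting is by the homotopy \<open>f t z = det (D - z I + t E z)\<close>, \<open>0 \<le> t \<le> 1\<close>. Since \<open>t E\<close> obeys the same
  bounds as \<open>E\<close>, the zeros of every \<open>f t\<close> lie in the same disks, so near \<open>U\<close> they cannot leave \<open>U\<close>.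
  The set \<open>U\<close> may have several components, so instead of a contour around it, Rouche's theorem
  is applied on small circles around the finitely many zeros of one \<open>f s\<close>: the number of zeros in \<open>U\<close>
  is locally constant in \<open>t\<close>, hence constant (\<open>zero_count_homotopy\<close>). At \<open>t = 0\<close> the determinant is
  \<open>\<Prod>\<^sub>i (d\<^sub>i - z)\<close>, whose zeros in \<open>U\<close> are the centres of the disks that make up \<open>U\<close>.
\<close>

section \<open>Generalized Gershgorin disks\<close>

text \<open>
  This is Hoelder's inequality with exponents \<open>1/(1-\<beta>)\<close> and \<open>1/\<beta>\<close> for the measure \<open>w\<close>. Writing the
  first factor with \<open>rpow\<close> lets \<open>\<beta> = 1\<close>, where the inequality is trivial, take part in the same
  statement, so that the column-sum case of the disk theorem needs no separate treatment.
\<close>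

lemma weighted_Hoelder:
  fixes w t :: "'a \<Rightarrow> real"
  assumes fin: "finite A" and w: "\<And>j. j \<in> A \<Longrightarrow> 0 \<le> w j" and t: "\<And>j. j \<in> A \<Longrightarrow> 0 \<le> t j"
    and \<beta>: "0 < \<beta>" "\<beta> \<le> 1"
  shows "(\<Sum>j\<in>A. w j * t j) \<le> rpow (\<Sum>j\<in>A. w j) (1 - \<beta>) * (\<Sum>j\<in>A. w j * t j powr (1/\<beta>)) powr \<beta>"
proof -
  define W where "W = (\<Sum>j\<in>A. w j)"
  define S where "S = (\<Sum>j\<in>A. w j * t j powr (1/\<beta>))"
  have W0: "0 \<le> W" and S0: "0 \<le> S"
    unfolding W_def S_def using w by (auto intro!: sum_nonneg)
  have rp: "0 \<le> rpow W (1 - \<beta>)" by (simp add: rpow_def)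
  show ?thesis
  proof (cases "S = 0")
    case True
    have "w j * t j powr (1/\<beta>) = 0" if "j \<in> A" for j
      using True that fin w unfolding S_def
      by (subst (asm) sum_nonneg_eq_0_iff) auto
    then have "w j * t j = 0" if "j \<in> A" for j
      using that by force
    then have "(\<Sum>j\<in>A. w j * t j) = 0" by (intro sum.neutral) simp
    then show ?thesis using rp by (simp add: W_def)
  next
    case False
    with S0 have S: "0 < S" by simp
    have "W \<noteq> 0"
    proof
      assume "W = 0"
      then have "w j = 0" if "j \<in> A" for j
        using that fin w unfolding W_def by (subst (asm) sum_nonneg_eq_0_iff) auto
      then have "S = 0" unfolding S_def by simp
      with S show False by simp
    qed
    with W0 have W: "0 < W" by simp
    (* After scaling t by (W/S) powr \<beta>, Young's inequality applied to 1 and the scaled value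
       sums to (1 - \<beta>) W + \<beta> W = W. *)
    have young: "w j * t j * (W/S) powr \<beta> \<le> w j * (1 - \<beta>) + \<beta> * (W/S) * (w j * t j powr (1/\<beta>))"
      if j: "j \<in> A" for j
    proof (cases "t j = 0")
      case True
      then show ?thesis using w[OF j] \<beta> by simp
    next
      case False
      with t[OF j] have tj: "0 < t j" by simp
      have "1 powr (1 - \<beta>) * (t j powr (1/\<beta>) * (W/S)) powr \<beta>
          \<le> (1 - \<beta>) * 1 + \<beta> * (t j powr (1/\<beta>) * (W/S))"
        using \<beta> W S tj by (intro Youngs_inequality_0) auto
      moreover have "(t j powr (1/\<beta>) * (W/S)) powr \<beta> = t j * (W/S) powr \<beta>"
        using W S tj \<beta> by (subst powr_mult) (auto simp: powr_powr)
      ultimately have "t j * (W/S) powr \<beta> \<le> (1 - \<beta>) + \<beta> * (t j powr (1/\<beta>) * (W/S))"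
        by simp
      from mult_left_mono[OF this w[OF j]] show ?thesis
        by (simp add: algebra_simps)
    qed
    have "(\<Sum>j\<in>A. w j * t j) * (W/S) powr \<beta>
        \<le> (\<Sum>j\<in>A. w j * (1 - \<beta>) + \<beta> * (W/S) * (w j * t j powr (1/\<beta>)))"
      unfolding sum_distrib_right by (intro sum_mono young)
    also have "\<dots> = W * (1 - \<beta>) + \<beta> * (W/S) * S"
      by (simp only: sum.distrib W_def S_def sum_distrib_left sum_distrib_right)
    also have "\<dots> = W" using S by (simp add: algebra_simps)
    finally have "(\<Sum>j\<in>A. w j * t j) * (W/S) powr \<beta> \<le> W" .
    then have "(\<Sum>j\<in>A. w j * t j) \<le> W / (W/S) powr \<beta>"
      using W S by (simp add: pos_le_divide_eq)
    also have "W / (W/S) powr \<beta> = W powr (1 - \<beta>) * S powr \<beta>"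
      using W S by (simp add: powr_divide powr_diff)
    also have "W powr (1 - \<beta>) = rpow W (1 - \<beta>)"
      using W by (simp add: rpow_def)
    finally show ?thesis by (simp add: W_def S_def)
  qed
qed

text \<open>
  For \<open>\<alpha> < 1\<close> this follows from Hoelder's inequality on each row and the column sums. At \<open>\<alpha> = 1\<close> the
  exponent \<open>1/(1-\<alpha>)\<close> is infinite, and the classical argument with a component of \<open>x\<close> of maximal
  modulus takes its place.
\<close>

lemma Ostrowski_disk:
  fixes a x :: "'n::finite \<Rightarrow> complex" and B :: "'n \<Rightarrow> 'n \<Rightarrow> complex" and r c :: "'n \<Rightarrow> real"
  assumes eq: "\<And>i. a i * x i = (\<Sum>j\<in>UNIV. B i j * x j)" and nz: "x k \<noteq> 0"
    and r: "\<And>i. (\<Sum>j\<in>UNIV. norm (B i j)) \<le> r i"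
    and c: "\<And>j. (\<Sum>i\<in>UNIV. norm (B i j)) \<le> c j"
    and \<alpha>: "0 \<le> \<alpha>" "\<alpha> \<le> 1"
  shows "\<exists>i. norm (a i) \<le> gersh_radius \<alpha> (r i) (c i)"
proof (rule ccontr)
  assume "\<not> ?thesis"
  then have out: "gersh_radius \<alpha> (r i) (c i) < norm (a i)" for i by (auto simp: not_le)
  have r0: "0 \<le> r i" for i by (rule order.trans[OF _ r]) (simp add: sum_nonneg)
  have c0: "0 \<le> c i" for i by (rule order.trans[OF _ c]) (simp add: sum_nonneg)
  have le: "norm (a i) * norm (x i) \<le> (\<Sum>j\<in>UNIV. norm (B i j) * norm (x j))" for i
    unfolding norm_mult[symmetric] eq by (rule norm_sum)
  show False
  proof (cases "\<alpha> = 1")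
    case True
    define M where "M = Max (range (\<lambda>i. norm (x i)))"
    have M: "norm (x j) \<le> M" for j unfolding M_def by simp
    have "M \<in> range (\<lambda>i. norm (x i))" unfolding M_def by (rule Max_in) auto
    then obtain i where i: "norm (x i) = M" by auto
    have M0: "0 < M" using M[of k] nz by (meson less_le_trans zero_less_norm_iff)
    have "norm (a i) * M \<le> (\<Sum>j\<in>UNIV. norm (B i j) * norm (x j))" using le[of i] i by simp
    also have "\<dots> \<le> (\<Sum>j\<in>UNIV. norm (B i j)) * M"
      unfolding sum_distrib_right by (intro sum_mono mult_left_mono M) auto
    also have "\<dots> \<le> r i * M" using r[of i] M0 by simp
    finally have "norm (a i) \<le> r i" using M0 by simp
    with out[of i] True r0[of i] show False by (simp add: gersh_radius_def rpow_def)
  next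
    case False
    define \<beta> where "\<beta> = 1 - \<alpha>"
    have \<beta>: "0 < \<beta>" "\<beta> \<le> 1" "\<alpha> = 1 - \<beta>" using False \<alpha> by (auto simp: \<beta>_def)
    define y where "y i = norm (x i) powr (1/\<beta>)" for i
    define S where "S i = (\<Sum>j\<in>UNIV. norm (B i j) * y j)" for i
    have y0: "0 \<le> y i" for i by (simp add: y_def)
    have S0: "0 \<le> S i" for i unfolding S_def by (intro sum_nonneg mult_nonneg_nonneg y0) auto
    have yb: "y i powr \<beta> = norm (x i)" for i using \<beta> by (simp add: y_def powr_powr)
    have H: "norm (a i) * norm (x i) \<le> rpow (r i) \<alpha> * S i powr \<beta>" for i
    proof -
      have "norm (a i) * norm (x i) \<le> rpow (\<Sum>j\<in>UNIV. norm (B i j)) (1 - \<beta>) * S i powr \<beta>"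
        unfolding S_def y_def by (rule order.trans[OF le weighted_Hoelder]) (use \<beta> in auto)
      also have "\<dots> \<le> rpow (r i) \<alpha> * S i powr \<beta>"
        unfolding \<beta>(3)[symmetric]
        by (intro mult_right_mono) (use r[of i] \<alpha> in \<open>auto simp: rpow_def sum_nonneg intro!: powr_mono2\<close>)
      finally show ?thesis .
    qed
    have strict: "c i * y i < S i" if "x i \<noteq> 0" for i
    proof (rule ccontr)
      assume "\<not> c i * y i < S i"
      then have "S i powr \<beta> \<le> (c i * y i) powr \<beta>"
        using S0[of i] \<beta> by (intro powr_mono2) auto
      also have "\<dots> = c i powr \<beta> * norm (x i)"
        using c0 y0 by (simp add: powr_mult yb)
      finally have "rpow (r i) \<alpha> * S i powr \<beta> \<le> rpow (r i) \<alpha> * (c i powr \<beta> * norm (x i))"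
        by (rule mult_left_mono) (simp add: rpow_def)
      also have "\<dots> = gersh_radius \<alpha> (r i) (c i) * norm (x i)"
        using \<beta> by (simp add: gersh_radius_def rpow_def)
      also have "\<dots> < norm (a i) * norm (x i)"
        using out[of i] that by simp
      finally show False using H[of i] by simp
    qed
    have weak: "c i * y i \<le> S i" for i
    proof (cases "x i = 0")
      case True
      then show ?thesis using S0 by (simp add: y_def)
    qed (use strict[of i] in simp)
    have "(\<Sum>i\<in>UNIV. c i * y i) < (\<Sum>i\<in>UNIV. S i)"
      by (rule sum_strict_mono_ex1) (use weak strict nz in auto)
    also have "\<dots> = (\<Sum>j\<in>UNIV. \<Sum>i\<in>UNIV. norm (B i j) * y j)"
      unfolding S_def by (rule sum.swap)
    also have "\<dots> \<le> (\<Sum>j\<in>UNIV. c j * y j)"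
      unfolding sum_distrib_right[symmetric] by (intro sum_mono mult_right_mono c y0)
    finally show False by simp
  qed
qed

section \<open>Stability of the number of zeros\<close>

text \<open>
  On a circle all winding numbers are 0 or 1, which turns Rouche's theorem into an equality of
  integer zero counts. The larger disk of radius \<open>R\<close> is the open set on which it is applied.
\<close>

lemma Rouche_disk:
  fixes g h :: "complex \<Rightarrow> complex"
  assumes r: "0 < r" "r < R"
    and g: "g holomorphic_on ball a R" and h: "h holomorphic_on ball a R"
    and fg: "finite {p \<in> ball a R. g p = 0}" and fh: "finite {p \<in> ball a R. h p = 0}"
    and less: "\<And>z. z \<in> sphere a r \<Longrightarrow> norm (h z - g z) < norm (g z)"
  shows "(\<Sum>p | p \<in> ball a r \<and> h p = 0. zorder h p) = (\<Sum>p | p \<in> ball a r \<and> g p = 0. zorder g p)"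
proof -
  let ?\<gamma> = "circlepath a r"
  have wn: "winding_number ?\<gamma> p = 0" if "p \<notin> cball a r" for p
    using r that by (intro winding_number_zero_outside[of _ "cball a r"]) auto
  have R: "(\<Sum>p\<in>{p\<in>ball a R. g p + (h p - g p) = 0}. winding_number ?\<gamma> p * zorder (\<lambda>p. g p + (h p - g p)) p)
      = (\<Sum>p\<in>{p\<in>ball a R. g p = 0}. winding_number ?\<gamma> p * zorder g p)"
  proof (rule Rouche_theorem)
    show "\<forall>z. z \<notin> ball a R \<longrightarrow> winding_number ?\<gamma> z = 0" using r by (auto intro!: wn)
  qed (use assms in \<open>auto intro: holomorphic_intros\<close>)
  have count: "(\<Sum>p\<in>{p\<in>ball a R. u p = 0}. winding_number ?\<gamma> p * zorder u p)
      = of_int (\<Sum>p | p \<in> ball a r \<and> u p = 0. zorder u p)"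
    if fin: "finite {p \<in> ball a R. u p = 0}" and nz: "\<And>z. z \<in> sphere a r \<Longrightarrow> u z \<noteq> 0"
    for u :: "complex \<Rightarrow> complex"
  proof -
    have "(\<Sum>p\<in>{p\<in>ball a R. u p = 0}. winding_number ?\<gamma> p * zorder u p)
      = (\<Sum>p | p \<in> ball a r \<and> u p = 0. winding_number ?\<gamma> p * zorder u p)"
    proof (rule sum.mono_neutral_right[OF fin])
      show "{p. p \<in> ball a r \<and> u p = 0} \<subseteq> {p \<in> ball a R. u p = 0}" using r by auto
      show "\<forall>p\<in>{p \<in> ball a R. u p = 0} - {p. p \<in> ball a r \<and> u p = 0}. winding_number ?\<gamma> p * zorder u p = 0"
      proof
        fix p assume "p \<in> {p \<in> ball a R. u p = 0} - {p. p \<in> ball a r \<and> u p = 0}"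
        then have "p \<notin> ball a r" "p \<notin> sphere a r" using nz by auto
        then have "p \<notin> cball a r" by auto
        then show "winding_number ?\<gamma> p * zorder u p = 0" by (simp add: wn)
      qed
    qed
    also have "\<dots> = (\<Sum>p | p \<in> ball a r \<and> u p = 0. of_int (zorder u p))"
      by (intro sum.cong refl) (auto simp: winding_number_circlepath dist_norm norm_minus_commute)
    finally show ?thesis by simp
  qed
  have nzg: "g z \<noteq> 0" "h z \<noteq> 0" if "z \<in> sphere a r" for z using less[OF that] by auto
  have "of_int (\<Sum>p | p \<in> ball a r \<and> h p = 0. zorder h p)
      = (of_int (\<Sum>p | p \<in> ball a r \<and> g p = 0. zorder g p) :: complex)"
    using R count[OF fg nzg(1)] count[OF fh nzg(2)] by simp
  then show ?thesis by (simp only: of_int_eq_iff)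
qed

lemma eventually_close_on_compact:
  fixes f :: "real \<Rightarrow> complex \<Rightarrow> complex"
  assumes K: "compact K" and cont: "continuous_on ({0..1} \<times> K) (\<lambda>(t, z). f t z)"
    and s: "s \<in> {0..1}" and nz: "\<And>z. z \<in> K \<Longrightarrow> f s z \<noteq> 0"
  shows "\<forall>\<^sub>F t in at s within {0..1}. \<forall>z\<in>K. norm (f t z - f s z) < norm (f s z)"
proof (cases "K = {}")
  case False
  have "continuous_on K (\<lambda>z. (\<lambda>(t, z). f t z) (s, z))"
    by (rule continuous_on_compose2[OF cont]) (use s in \<open>auto intro!: continuous_intros\<close>)
  then have "continuous_on K (\<lambda>z. norm (f s z))" by (auto intro: continuous_on_norm)
  from continuous_attains_inf[OF K False this]
  obtain z0 where z0: "z0 \<in> K" "\<And>z. z \<in> K \<Longrightarrow> norm (f s z0) \<le> norm (f s z)" by blast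
  have "uniformly_continuous_on ({0..1} \<times> K) (\<lambda>(t, z). f t z)"
    by (intro compact_uniformly_continuous cont compact_Times K) auto
  then obtain d where d: "d > 0" and
    u: "\<And>p q. p \<in> {0..1} \<times> K \<Longrightarrow> q \<in> {0..1} \<times> K \<Longrightarrow> dist q p < d \<Longrightarrow>
        dist ((\<lambda>(t, z). f t z) q) ((\<lambda>(t, z). f t z) p) < norm (f s z0)"
    unfolding uniformly_continuous_on_def using nz[OF z0(1)] by (metis zero_less_norm_iff)
  have "norm (f t z - f s z) < norm (f s z)" if "t \<in> {0..1}" "dist t s < d" "z \<in> K" for t z
    using u[of "(s, z)" "(t, z)"] that s z0(2)[of z] by (auto simp: dist_Pair_Pair dist_norm)
  then show ?thesis using d unfolding eventually_at by blast
qed auto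

text \<open>
  The factor 2 makes the disks of radius \<open>r\<close> disjoint and keeps their boundary circles away from \<open>Z\<close>.
\<close>

lemma finite_separation_radius:
  fixes Z :: "'a::metric_space set"
  assumes "finite Z" "open W" "Z \<subseteq> W"
  obtains r where "r > 0" "\<And>z. z \<in> Z \<Longrightarrow> ball z (2 * r) \<subseteq> W - (Z - {z})"
proof -
  have "\<exists>e>0. ball z e \<subseteq> W - (Z - {z})" if "z \<in> Z" for z
  proof -
    have "open (W - (Z - {z}))" using assms by (intro open_Diff finite_imp_closed) auto
    then show ?thesis using that assms(3) unfolding open_contains_ball by blast
  qed
  then obtain e where e: "\<And>z. z \<in> Z \<Longrightarrow> e z > 0 \<and> ball z (e z) \<subseteq> W - (Z - {z})" by metis
  define r where "r = Min (insert 1 (e ` Z)) / 2"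
  have "r > 0" unfolding r_def using assms(1) e by (auto simp: Min_gr_iff)
  moreover have "ball z (2 * r) \<subseteq> W - (Z - {z})" if "z \<in> Z" for z
  proof -
    have "2 * r \<le> e z" unfolding r_def using assms(1) that by simp
    then show ?thesis using e[OF that] subset_ball by blast
  qed
  ultimately show ?thesis by (rule that)
qed

text \<open>
  Zeros move continuously with \<open>t\<close> and cannot cross from \<open>U\<close> into \<open>W - U\<close>, so their number in \<open>U\<close> does
  not change. Locally, for \<open>t\<close> near \<open>s\<close>, the function \<open>f t\<close> has no zero in \<open>U\<close> outside small disks
  around the zeros of \<open>f s\<close>, and in each disk it has as many as \<open>f s\<close> has at the centre.
\<close>

lemma zero_count_homotopy:
  fixes f :: "real \<Rightarrow> complex \<Rightarrow> complex"
  assumes W: "open W" and U: "compact U" "U \<subseteq> W"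
    and cont: "continuous_on ({0..1} \<times> W) (\<lambda>(t, z). f t z)"
    and holo: "\<And>t. t \<in> {0..1} \<Longrightarrow> f t holomorphic_on W"
    and nz: "\<And>t z. t \<in> {0..1} \<Longrightarrow> z \<in> W - U \<Longrightarrow> f t z \<noteq> 0"
    and fin: "\<And>t. t \<in> {0..1} \<Longrightarrow> finite {z \<in> U. f t z = 0}"
  shows "(\<Sum>z | z \<in> U \<and> f 0 z = 0. zorder (f 0) z) = (\<Sum>z | z \<in> U \<and> f 1 z = 0. zorder (f 1) z)"
proof -
  define N where "N t = (\<Sum>z | z \<in> U \<and> f t z = 0. zorder (f t) z)" for t
  have "\<forall>\<^sub>F t in at s within {0..1}. N s = N t" if s: "s \<in> {0..1}" for s
  proof -
    define Z where "Z = {z \<in> U. f s z = 0}"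
    have finZ: "finite Z" and ZW: "Z \<subseteq> W" using fin[OF s] U by (auto simp: Z_def)
    obtain r where r: "r > 0" and sep: "\<And>z. z \<in> Z \<Longrightarrow> ball z (2 * r) \<subseteq> W - (Z - {z})"
      using finite_separation_radius[OF finZ W ZW] by blast
    have inB: "x \<in> W" "x \<in> Z \<Longrightarrow> x = z" if "z \<in> Z" "dist z x < 2 * r" for x z
      using sep[OF that(1)] that(2) by (auto simp: subset_iff)
    (* The compact set on which f t must stay close to f s: the part of U outside the small disks,
       to exclude new zeros, and the circles, for Rouche's theorem. *)
    define K where "K = (U - (\<Union>z\<in>Z. ball z r)) \<union> (\<Union>z\<in>Z. sphere z r)"
    have "compact K" unfolding K_def using U finZ
      by (intro compact_Un compact_diff compact_UN open_UN) auto
    moreover have KW: "K \<subseteq> W" using U inB(1) r by (auto simp: K_def)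
    moreover have "f s z \<noteq> 0" if "z \<in> K" for z
    proof
      assume "f s z = 0"
      moreover have "z \<in> W" using that KW by auto
      ultimately have "z \<in> Z" using nz[OF s] by (auto simp: Z_def)
      with that r obtain z' where "z' \<in> Z" "z \<in> sphere z' r" by (auto simp: K_def)
      with inB(2)[of z' z] \<open>z \<in> Z\<close> r show False by auto
    qed
    ultimately have ev: "\<forall>\<^sub>F t in at s within {0..1}. \<forall>z\<in>K. norm (f t z - f s z) < norm (f s z)"
      by (intro eventually_close_on_compact s) (auto intro: continuous_on_subset[OF cont])
    have ev1: "\<forall>\<^sub>F t in at s within {0..1}. t \<in> {0..1::real}"
      by (simp add: eventually_at_filter)
    show ?thesis using ev ev1
    proof eventually_elim
      case (elim t)
      have t: "t \<in> {0..1}" by fact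
      have fB: "finite {p \<in> ball a (2 * r). f t' p = 0}" if "a \<in> Z" "t' \<in> {0..1}" for a t'
        using inB(1)[OF that(1)] nz[OF that(2)] by (intro finite_subset[OF _ fin[OF that(2)]]) auto
      have loc: "(\<Sum>p | p \<in> ball a r \<and> f t p = 0. zorder (f t) p) = zorder (f s) a" if a: "a \<in> Z" for a
      proof -
        have "(\<Sum>p | p \<in> ball a r \<and> f t p = 0. zorder (f t) p) = (\<Sum>p | p \<in> ball a r \<and> f s p = 0. zorder (f s) p)"
        proof (rule Rouche_disk[where R = "2 * r"])
          show "f s holomorphic_on ball a (2 * r)" "f t holomorphic_on ball a (2 * r)"
            using s t inB(1)[OF a] by (auto intro!: holomorphic_on_subset[OF holo])
          show "norm (f t z - f s z) < norm (f s z)" if "z \<in> sphere a r" for z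
          proof -
            have "z \<in> K" unfolding K_def by (rule UnI2, rule UN_I[OF a], rule that)
            with elim(1) show ?thesis by (rule bspec)
          qed
        qed (use r fB a s t in auto)
        also have "{p. p \<in> ball a r \<and> f s p = 0} = {a}"
        proof (intro equalityI subsetI)
          fix p assume "p \<in> {p. p \<in> ball a r \<and> f s p = 0}"
          then have p: "dist a p < 2 * r" "f s p = 0" using r by auto
          with inB(1)[OF a p(1)] nz[OF s, of p] have "p \<in> Z" by (auto simp: Z_def)
          with inB(2)[OF a p(1)] show "p \<in> {a}" by simp
        qed (use a r in \<open>auto simp: Z_def\<close>)
        finally show ?thesis by simp
      qed
      have "{z. z \<in> U \<and> f t z = 0} = (\<Union>a\<in>Z. {p. p \<in> ball a r \<and> f t p = 0})"
      proof (intro equalityI subsetI)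
        fix z assume z: "z \<in> {z. z \<in> U \<and> f t z = 0}"
        then have "z \<notin> K" using elim(1) by force
        with z show "z \<in> (\<Union>a\<in>Z. {p. p \<in> ball a r \<and> f t p = 0})" by (auto simp: K_def)
      next
        fix z assume "z \<in> (\<Union>a\<in>Z. {p. p \<in> ball a r \<and> f t p = 0})"
        then obtain a where "a \<in> Z" "dist a z < r" "f t z = 0" by auto
        with r inB(1)[of a z] nz[OF t, of z] show "z \<in> {z. z \<in> U \<and> f t z = 0}" by auto
      qed
      then have "N t = (\<Sum>p\<in>(\<Union>a\<in>Z. {p. p \<in> ball a r \<and> f t p = 0}). zorder (f t) p)"
        by (simp add: N_def)
      also have "\<dots> = (\<Sum>a\<in>Z. \<Sum>p | p \<in> ball a r \<and> f t p = 0. zorder (f t) p)"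
      proof (rule sum.UNION_disjoint[OF finZ])
        show "\<forall>a\<in>Z. finite {p. p \<in> ball a r \<and> f t p = 0}"
          using r by (auto intro!: finite_subset[OF _ fB[OF _ t]])
        show "\<forall>a\<in>Z. \<forall>b\<in>Z. a \<noteq> b \<longrightarrow> {p. p \<in> ball a r \<and> f t p = 0} \<inter> {p. p \<in> ball b r \<and> f t p = 0} = {}"
        proof (intro ballI impI)
          fix a b assume ab: "a \<in> Z" "b \<in> Z" "a \<noteq> b"
          then have "2 * r \<le> dist a b" using inB(2)[of a b] by force
          then have "ball a r \<inter> ball b r = {}" by (intro disjoint_ballI) auto
          then show "{p. p \<in> ball a r \<and> f t p = 0} \<inter> {p. p \<in> ball b r \<and> f t p = 0} = {}" by blast
        qed
      qed
      also have "\<dots> = N s" using loc by (simp add: N_def Z_def)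
      finally show "N s = N t" by simp
    qed
  qed
  then have "N 0 = N 1"
    by (intro connected_local_const[of "{0..1::real}"]) auto
  then show ?thesis by (simp add: N_def)
qed

section \<open>Determinants of matrix functions\<close>

lemma holomorphic_on_det:
  fixes A :: "complex \<Rightarrow> complex^'n^'n"
  assumes "\<And>i j. (\<lambda>z. A z $ i $ j) holomorphic_on S"
  shows "(\<lambda>z. det (A z)) holomorphic_on S"
  unfolding det_def by (intro holomorphic_intros assms)

lemma continuous_on_det:
  fixes A :: "'a::topological_space \<Rightarrow> complex^'n^'n"
  assumes "\<And>i j. continuous_on S (\<lambda>x. A x $ i $ j)"
  shows "continuous_on S (\<lambda>x. det (A x))"
  unfolding det_def by (intro continuous_intros assms)

lemma det_zero_in_gersh_disk:
  fixes D B :: "complex^'n^'n" and r c :: "'n \<Rightarrow> real"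
  assumes D: "\<And>i j. i \<noteq> j \<Longrightarrow> D $ i $ j = 0"
    and sing: "det (D - mat z + B) = 0"
    and r: "\<And>i. (\<Sum>j\<in>UNIV. norm (B $ i $ j)) \<le> r i"
    and c: "\<And>j. (\<Sum>i\<in>UNIV. norm (B $ i $ j)) \<le> c j"
    and \<alpha>: "0 \<le> \<alpha>" "\<alpha> \<le> 1"
  shows "z \<in> (\<Union>i. gersh_disk D r c \<alpha> i)"
proof -
  have "\<not> invertible (D - mat z + B)" using sing by (simp add: invertible_det_nz)
  then obtain x where x: "(D - mat z + B) *v x = 0" "x \<noteq> 0"
    by (metis invertible_left_inverse matrix_left_invertible_ker)
  from x(2) obtain k where k: "x $ k \<noteq> 0" by (auto simp: vec_eq_iff)
  have eq: "(z - D $ i $ i) * x $ i = (\<Sum>j\<in>UNIV. B $ i $ j * x $ j)" for i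
  proof -
    have "0 = ((D - mat z + B) *v x) $ i" by (simp add: x(1))
    also have "\<dots> = (\<Sum>j\<in>UNIV. (if j = i then (D $ i $ i - z) * x $ i else 0) + B $ i $ j * x $ j)"
      unfolding matrix_vector_mult_def
      by (simp, intro sum.cong refl) (auto simp: mat_def D algebra_simps)
    also have "\<dots> = (D $ i $ i - z) * x $ i + (\<Sum>j\<in>UNIV. B $ i $ j * x $ j)"
      by (simp add: sum.distrib)
    finally show ?thesis by (simp add: algebra_simps)
  qed
  obtain i where "norm (z - D $ i $ i) \<le> gersh_radius \<alpha> (r i) (c i)"
    using Ostrowski_disk[where B = "\<lambda>i j. B $ i $ j", OF eq k r c \<alpha>] by blast
  then show ?thesis by (auto simp: gersh_disk_def dist_norm norm_minus_commute)
qed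

lemma zorder_linear_factor:
  fixes a z :: complex
  shows "zorder (\<lambda>w. a - w) z = (if a = z then 1 else 0)"
proof (cases "a = z")
  case True
  have "zorder (\<lambda>w. a - w) z = 1"
    by (rule zorder_eqI[where S = UNIV and g = "\<lambda>_. -1"]) (use True in auto)
  then show ?thesis using True by simp
next
  case False
  have "zorder (\<lambda>w. a - w) z = 0"
    by (rule zorder_eq_0I) (use False in \<open>auto intro!: analytic_intros\<close>)
  then show ?thesis using False by simp
qed

lemma sum_zorder_prod_linear:
  fixes d :: "'n::finite \<Rightarrow> complex"
  shows "(\<Sum>z | z \<in> U \<and> (\<Prod>i\<in>UNIV. d i - z) = 0. zorder (\<lambda>z. \<Prod>i\<in>UNIV. d i - z) z)
    = int (card {i. d i \<in> U})"
proof -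
  have "zorder (\<lambda>z. \<Prod>i\<in>UNIV. d i - z) z = (\<Sum>i\<in>UNIV. if d i = z then 1 else 0)" for z
  proof -
    have "\<forall>\<^sub>F w in at z. \<forall>i. d i - w \<noteq> 0"
      by (rule eventually_all_finite)
        (auto intro!: eventually_mono[OF eventually_neq_at_within])
    then have "\<forall>\<^sub>F w in at z. (\<Prod>i\<in>UNIV. d i - w) \<noteq> 0"
      by (rule eventually_mono) simp
    then show ?thesis
      by (subst zorder_prod_analytic) (auto intro!: analytic_intros simp: zorder_linear_factor)
  qed
  moreover have "{z. z \<in> U \<and> (\<Prod>i\<in>UNIV. d i - z) = 0} = U \<inter> range d" by auto
  ultimately have "(\<Sum>z | z \<in> U \<and> (\<Prod>i\<in>UNIV. d i - z) = 0. zorder (\<lambda>z. \<Prod>i\<in>UNIV. d i - z) z)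
    = (\<Sum>z\<in>U \<inter> range d. \<Sum>i\<in>UNIV. if d i = z then 1 else 0)"
    by simp
  also have "\<dots> = (\<Sum>i\<in>UNIV. \<Sum>z\<in>U \<inter> range d. if d i = z then 1 else 0)"
    by (rule sum.swap)
  also have "\<dots> = (\<Sum>i\<in>UNIV. if d i \<in> U then 1 else 0)"
    by (intro sum.cong refl) (simp add: sum.delta')
  also have "\<dots> = int (card {i. d i \<in> U})"
    by (simp add: sum.If_cases)
  finally show ?thesis .
qed

text \<open>
  A connected open \<open>\<Omega>\<close> covered by \<open>U\<close> and \<open>V\<close> would make the nonempty
  compact set \<open>U\<close> open, which the plane does not allow. The point obtained here
  lies outside all disks, which keeps every determinant of the homotopy from vanishing identically.
\<close>

lemma open_connected_not_in_union:
  fixes U V \<Omega> :: "complex set"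
  assumes \<Omega>: "open \<Omega>" "connected \<Omega>" and U: "compact U" "U \<noteq> {}" "U \<subseteq> \<Omega>"
    and V: "closed V" "U \<inter> V = {}"
  obtains w where "w \<in> \<Omega>" "w \<notin> U \<union> V"
proof -
  have "\<not> \<Omega> \<subseteq> U \<union> V"
  proof
    assume sub: "\<Omega> \<subseteq> U \<union> V"
    then have "U = \<Omega> - V" using U V by auto
    then have "open U" using \<Omega> V by auto
    then have "U = UNIV" using U compact_imp_closed clopen by blast
    then show False using U(1) compact_imp_bounded not_bounded_UNIV by blast
  qed
  then show ?thesis using that by blast
qed

section \<open>Localization and counting of eigenvalues\<close>

theorem corollary5p2:
  fixes \<Omega> :: "complex set"
    and T E :: "complex \<Rightarrow> complex^'n^'n"
    and D :: "complex^'n^'n"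
    and r c :: "'n \<Rightarrow> real"
    and \<alpha> :: real
  assumes "open \<Omega>" and "connected \<Omega>" and "\<Omega> \<noteq> {}" and "simply_connected \<Omega>"
    and "\<And>i j. i \<noteq> j \<Longrightarrow> D $ i $ j = 0"
    and "analytic_matrix E \<Omega>"
    and "\<And>z. z \<in> \<Omega> \<Longrightarrow> T z = D - mat z + E z"
    and "regular_matrix T \<Omega>"
    and "\<And>z i. z \<in> \<Omega> \<Longrightarrow> (\<Sum>j\<in>UNIV. norm (E z $ i $ j)) \<le> r i"
    and "\<And>z j. z \<in> \<Omega> \<Longrightarrow> (\<Sum>i\<in>UNIV. norm (E z $ i $ j)) \<le> c j"
    and "0 \<le> \<alpha>" and "\<alpha> \<le> 1"
  shows "matrix_eigenvalues T \<Omega> \<subseteq> (\<Union>i. gersh_disk D r c \<alpha> i) \<and>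
    (\<forall>J U k. U = (\<Union>i\<in>J. gersh_disk D r c \<alpha> i) \<and> card J = k \<and>
         U \<inter> (\<Union>i\<in>- J. gersh_disk D r c \<alpha> i) = {} \<and> U \<subseteq> \<Omega> \<longrightarrow>
       finite (matrix_eigenvalues T \<Omega> \<inter> U) \<and>
       (\<Sum>z\<in>matrix_eigenvalues T \<Omega> \<inter> U. eigenvalue_mult T z) = int k)"
proof -
  note D = assms(5) and T = assms(7) and \<alpha> = assms(11,12)
  let ?G = "gersh_disk D r c \<alpha>"
  define f where "f t z = det (D - mat z + t *\<^sub>R E z)" for t z
  have sumle: "(\<Sum>k\<in>UNIV. norm (t *\<^sub>R e k)) \<le> b"
    if "t \<in> {0..1}" "(\<Sum>k\<in>UNIV. norm (e k)) \<le> b" for t b and e :: "'n \<Rightarrow> complex"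
  proof -
    have "(\<Sum>k\<in>UNIV. norm (t *\<^sub>R e k)) \<le> (\<Sum>k\<in>UNIV. norm (e k))"
      using that(1) by (intro sum_mono) (auto intro: mult_left_le_one_le)
    with that(2) show ?thesis by simp
  qed
  have loc: "z \<in> (\<Union>i. ?G i)" if "z \<in> \<Omega>" "t \<in> {0..1}" "f t z = 0" for z t
  proof (rule det_zero_in_gersh_disk[OF D _ _ _ \<alpha>])
    show "det (D - mat z + t *\<^sub>R E z) = 0" using that by (simp add: f_def)
    show "(\<Sum>j\<in>UNIV. norm ((t *\<^sub>R E z) $ i $ j)) \<le> r i" for i
      using sumle[OF that(2) assms(9)[OF that(1)]] by simp
    show "(\<Sum>i\<in>UNIV. norm ((t *\<^sub>R E z) $ i $ j)) \<le> c j" for j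
      using sumle[OF that(2) assms(10)[OF that(1)]] by simp
  qed
  have f1: "f 1 z = det (T z)" if "z \<in> \<Omega>" for z using that by (simp add: f_def T)
  have ev: "matrix_eigenvalues T \<Omega> = {z \<in> \<Omega>. f 1 z = 0}"
    by (auto simp: matrix_eigenvalues_def invertible_det_nz f1)
  have E: "(\<lambda>z. E z $ i $ j) holomorphic_on \<Omega>" for i j
    using assms(6) by (auto simp: analytic_matrix_def intro: analytic_imp_holomorphic)
  have mat_holo: "(\<lambda>z. mat z $ i $ j) holomorphic_on \<Omega>" for i j :: 'n
    by (cases "i = j") (auto simp: mat_def)
  have mat_cont: "continuous_on X (\<lambda>p. mat (g p) $ i $ j)"
    if "continuous_on X g" for X and g :: "real \<times> complex \<Rightarrow> complex" and i j :: 'n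
    using that by (cases "i = j") (auto simp: mat_def)
  have holo: "f t holomorphic_on \<Omega>" for t
    unfolding f_def[abs_def]
    by (rule holomorphic_on_det) (auto simp: scaleR_conv_of_real intro!: holomorphic_intros E mat_holo)
  have cont: "continuous_on ({0..1} \<times> \<Omega>) (\<lambda>(t, z). f t z)"
  proof -
    have "continuous_on ({0..1::real} \<times> \<Omega>) (\<lambda>p. E (snd p) $ i $ j)" for i j
      by (rule continuous_on_compose2[OF holomorphic_on_imp_continuous_on[OF E]])
        (auto intro!: continuous_intros)
    moreover have "continuous_on ({0..1::real} \<times> \<Omega>) (\<lambda>p. mat (snd p) $ i $ j)" for i j :: 'n
      by (rule mat_cont) (rule continuous_on_snd[OF continuous_on_id])
    ultimately have "continuous_on ({0..1} \<times> \<Omega>) (\<lambda>p. (D - mat (snd p) + fst p *\<^sub>R E (snd p)) $ i $ j)" for i j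
      unfolding vector_add_component vector_minus_component vector_scaleR_component
      by (intro continuous_on_add continuous_on_diff continuous_on_scaleR continuous_on_const
          continuous_on_fst continuous_on_id)
    then show ?thesis
      unfolding f_def case_prod_beta by (rule continuous_on_det)
  qed
  have f0: "f 0 z = (\<Prod>i\<in>UNIV. D $ i $ i - z)" for z
    unfolding f_def by (subst det_diagonal) (auto simp: D mat_def)
  have "finite (matrix_eigenvalues T \<Omega> \<inter> U) \<and>
      (\<Sum>z\<in>matrix_eigenvalues T \<Omega> \<inter> U. eigenvalue_mult T z) = int (card J)"
    if U: "U = (\<Union>i\<in>J. ?G i)" and disj: "U \<inter> (\<Union>i\<in>- J. ?G i) = {}" and sub: "U \<subseteq> \<Omega>"
    for J U
  proof (cases "J = {}")
    case True
    then show ?thesis using U by simp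
  next
    case False
    define V where "V = (\<Union>i\<in>- J. ?G i)"
    have UV: "(\<Union>i. ?G i) = U \<union> V" unfolding U V_def by auto
    have V: "closed V" "U \<inter> V = {}"
      using disj by (auto simp: V_def gersh_disk_def)
    have cU: "compact U" unfolding U by (intro compact_UN) (auto simp: gersh_disk_def)
    have centre: "D $ i $ i \<in> ?G i" for i
    proof -
      obtain z where z: "z \<in> \<Omega>" using assms(3) by blast
      have "0 \<le> c i" by (rule order.trans[OF _ assms(10)[OF z]]) (simp add: sum_nonneg)
      then show ?thesis by (simp add: gersh_disk_def gersh_radius_def rpow_def)
    qed
    have "U \<noteq> {}" unfolding U using False centre by blast
    then obtain w where w: "w \<in> \<Omega>" "w \<notin> U \<union> V"
      by (rule open_connected_not_in_union[OF assms(1,2) cU _ sub V])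
    have fin: "finite {z \<in> U. f t z = 0}" if t: "t \<in> {0..1}" for t
    proof (cases "f t constant_on \<Omega>")
      case True
      then have "f t z = f t w" if "z \<in> U" for z
        using that sub w(1) unfolding constant_on_def by (metis subsetD)
      moreover have "f t w \<noteq> 0" using loc[OF w(1) t] w(2) UV by auto
      ultimately have "{z \<in> U. f t z = 0} = {}" by auto
      then show ?thesis by (simp only: finite.emptyI)
    qed (rule holomorphic_compact_finite_zeros[OF holo assms(1,2) cU sub])
    have "(\<Sum>z | z \<in> U \<and> f 0 z = 0. zorder (f 0) z) = (\<Sum>z | z \<in> U \<and> f 1 z = 0. zorder (f 1) z)"
    proof (rule zero_count_homotopy[where W = "\<Omega> - V"])
      show "f t z \<noteq> 0" if "t \<in> {0..1}" "z \<in> \<Omega> - V - U" for t z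
        using loc[of z t] that UV by auto
      show "open (\<Omega> - V)" using assms(1) V(1) by (rule open_Diff)
      show "U \<subseteq> \<Omega> - V" using sub V(2) by blast
      show "continuous_on ({0..1} \<times> (\<Omega> - V)) (\<lambda>(t, z). f t z)"
        by (rule continuous_on_subset[OF cont]) blast
      show "f t holomorphic_on \<Omega> - V" for t
        by (rule holomorphic_on_subset[OF holo Diff_subset])
    qed (fact cU, fact fin)
    moreover have "(\<Sum>z | z \<in> U \<and> f 0 z = 0. zorder (f 0) z) = int (card {i. D $ i $ i \<in> U})"
      unfolding f0[abs_def] by (rule sum_zorder_prod_linear)
    moreover have "{i. D $ i $ i \<in> U} = J"
    proof (intro equalityI subsetI)
      fix i assume "i \<in> {i. D $ i $ i \<in> U}"
      then have "D $ i $ i \<notin> V" using V(2) by blast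
      then show "i \<in> J" using centre[of i] by (auto simp: V_def)
    next
      fix i assume "i \<in> J"
      then have "D $ i $ i \<in> U" unfolding U by (rule UN_I) (rule centre)
      then show "i \<in> {i. D $ i $ i \<in> U}" by simp
    qed
    moreover have eq: "matrix_eigenvalues T \<Omega> \<inter> U = {z. z \<in> U \<and> f 1 z = 0}"
      using ev sub by auto
    moreover have "eigenvalue_mult T z = zorder (f 1) z" if "z \<in> U" for z
    proof -
      have "\<forall>\<^sub>F w in nhds z. w \<in> \<Omega>"
        using that sub assms(1) by (intro eventually_nhds_in_open) auto
      then have "\<forall>\<^sub>F w in at z. det (T w) = f 1 w"
        unfolding eventually_at_filter by (rule eventually_mono) (simp add: f1)
      then show ?thesis unfolding eigenvalue_mult_def by (rule zorder_cong) simp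
    qed
    ultimately have sum: "(\<Sum>z\<in>matrix_eigenvalues T \<Omega> \<inter> U. eigenvalue_mult T z) = int (card J)"
      by simp
    have "finite (matrix_eigenvalues T \<Omega> \<inter> U)" unfolding eq by (rule fin) simp
    then show ?thesis using sum by (rule conjI)
  qed
  moreover have "matrix_eigenvalues T \<Omega> \<subseteq> (\<Union>i. ?G i)"
    unfolding ev by (rule subsetI, rule loc[where t = 1]) auto
  ultimately show ?thesis by blast
qed

end
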